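(* If a polygon $A_1A_2A_3\dots A_{n-1}A_n$ can be inscribed in a semicircle with diameter $A_1A_n$, then $$\left(A_1A_n\right)^2 = \sum_{k=1}^{n-1}\left(A_kA_{k+1}\right)^2 + 2\sum_{k=1}^{n-3}\frac{\left(A_1A_{k+1}\right)\left(A_{k+1}A_{k+2}\right)\left(A_{k+2}A_n\right)}{A_1A_n}.$$
   Context: A polygon $A_1A_2\dots A_n$ ($n\ge 3$) is an ordinary (simple) polygon in the Euclidean plane whose vertices are listed in order along its boundary. It is inscribed in a semicircle with diameter $A_1A_n$ if all its vertices lie on that semicircle (with endpoints $A_1$ and $A_n$), so that $A_1, A_2, \dots, A_n$ occur in this order along the semicircle. For points $P, Q$, $PQ$ denotes the length of the segment from $P$ to $Q$. A sum with no terms (the second sum when $n=3$) equals $0$. *)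

theory Defs
  imports "HOL-Analysis.Analysis"
begin

text \<open>Vertices are indexed by 1, ..., n; the values of A outside this range are irrelevant.\<close>

definition next_vertex :: "nat \<Rightarrow> nat \<Rightarrow> nat" where
  "next_vertex n i = (if i = n then 1 else i + 1)"

definition polygon_side :: "nat \<Rightarrow> (nat \<Rightarrow> real^2) \<Rightarrow> nat \<Rightarrow> (real^2) set" where
  "polygon_side n A i = closed_segment (A i) (A (next_vertex n i))"

text \<open>Two different sides meet in their common endpoint if they are adjacent, and are
  disjoint otherwise.\<close>

definition simple_polygon :: "nat \<Rightarrow> (nat \<Rightarrow> real^2) \<Rightarrow> bool" where
  "simple_polygon n A \<longleftrightarrow>
     3 \<le> n \<and> inj_on A {1..n} \<and>
     (\<forall>i\<in>{1..n}. \<forall>j\<in>{1..n}. i \<noteq> j \<longrightarrow>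
        polygon_side n A i \<inter> polygon_side n A j =
        {A i, A (next_vertex n i)} \<inter> {A j, A (next_vertex n j)})"

text \<open>For r > 0 and orthonormal u, v, as t runs through {0..pi} this traverses the closed
  semicircle with centre c and radius r on the v-side of its diameter, from c + r u to c - r u.
  Since (u, v) may have either orientation, every semicircle of the plane, traversed in either
  direction, arises in this way.\<close>

definition semicircle_path ::
    "real^2 \<Rightarrow> real \<Rightarrow> real^2 \<Rightarrow> real^2 \<Rightarrow> real \<Rightarrow> real^2" where
  "semicircle_path c r u v t = c + (r * cos t) *\<^sub>R u + (r * sin t) *\<^sub>R v"

text \<open>The conditions on \<open>\<theta> 1\<close> and \<open>\<theta> n\<close> say that the diameter is the segment from A 1 to A n.\<close>

definition inscribed_in_semicircle :: "nat \<Rightarrow> (nat \<Rightarrow> real^2) \<Rightarrow> bool" where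
  "inscribed_in_semicircle n A \<longleftrightarrow>
     (\<exists>c r u v \<theta>. r > 0 \<and> norm u = 1 \<and> norm v = 1 \<and> u \<bullet> v = 0 \<and>
        \<theta> 1 = 0 \<and> \<theta> n = pi \<and> strict_mono_on {1..n} \<theta> \<and>
        (\<forall>k\<in>{1..n}. A k = semicircle_path c r u v (\<theta> k)))"

end

theory Submission
  imports Defs
begin

text \<open>
  Let \<open>P = A 1\<close>, \<open>Q = A n\<close>, and consider the triangle with vertices \<open>P\<close>, \<open>A k\<close>,
  \<open>A (k+1)\<close>. The quadrilateral \<open>P, A k, A (k+1), Q\<close> is cyclic, so the angle at \<open>A k\<close> in
  this triangle is supplementary to the angle at \<open>Q\<close> in the triangle \<open>P, A (k+1), Q\<close>. By Thales
  the latter triangle has a right angle at \<open>A (k+1)\<close>, so the cosine of its angle at \<open>Q\<close> is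
  \<open>dist (A (k+1)) Q / dist P Q\<close>. The law of cosines therefore reads
  \[
    |P A_{k+1}|^2 - |P A_k|^2
      = |A_k A_{k+1}|^2 + 2 \, |P A_k| \, |A_k A_{k+1}| \, |A_{k+1} Q| \, / \, |P Q| ,
  \]
  which is \<open>law_of_cosines_in_semicircle\<close>. Summing over \<open>k = 1, \<dots>, n - 1\<close>, the left-hand side
  telescopes to \<open>|P Q|\<^sup>2\<close>. The products for \<open>k = 1\<close> and \<open>k = n - 1\<close> contain a factor
  \<open>|P P|\<close> and \<open>|Q Q|\<close> respectively, so only those for \<open>2 \<le> k \<le> n - 2\<close> remain; shifting the
  index by one gives the second sum of the theorem.

  The law of cosines is proved from the chord length formula, which turns it into a trigonometric
  identity and covers the degenerate positions \<open>A k = P\<close> and \<open>A (k+1) = Q\<close> as well.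
\<close>

lemma dist_semicircle_path:
  assumes "r \<ge> 0" "norm u = 1" "norm v = 1" "u \<bullet> v = 0"
    and "s \<le> t" "t - s \<le> 2 * pi"
  shows "dist (semicircle_path c r u v s) (semicircle_path c r u v t) = 2 * r * sin ((t - s) / 2)"
proof -
  define a b where "a = r * (cos s - cos t)" and "b = r * (sin s - sin t)"
  have uu: "u \<bullet> u = 1" and vv: "v \<bullet> v = 1"
    using assms(2,3) by (simp_all add: dot_square_norm)
  have "semicircle_path c r u v s - semicircle_path c r u v t = a *\<^sub>R u + b *\<^sub>R v"
    unfolding semicircle_path_def a_def b_def by (simp add: algebra_simps)
  then have "(dist (semicircle_path c r u v s) (semicircle_path c r u v t))\<^sup>2
      = (a *\<^sub>R u + b *\<^sub>R v) \<bullet> (a *\<^sub>R u + b *\<^sub>R v)"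
    by (simp add: dist_norm power2_norm_eq_inner)
  also have "\<dots> = a\<^sup>2 + b\<^sup>2"
    using uu vv assms(4)
    by (simp add: inner_add_left inner_add_right inner_commute power2_eq_square)
  also have "\<dots> = r\<^sup>2 * ((cos s)\<^sup>2 + (sin s)\<^sup>2 + ((cos t)\<^sup>2 + (sin t)\<^sup>2)
      - 2 * (cos t * cos s + sin t * sin s))"
    unfolding a_def b_def by algebra
  also have "\<dots> = r\<^sup>2 * (2 - 2 * cos (t - s))"
    by (simp add: cos_diff[symmetric])
  also have "cos (t - s) = 1 - 2 * (sin ((t - s) / 2))\<^sup>2"
    using cos_double_sin[of "(t - s) / 2"] by (simp only: mult_2 field_sum_of_halves)
  also have "r\<^sup>2 * (2 - 2 * (1 - 2 * (sin ((t - s) / 2))\<^sup>2)) = (2 * r * sin ((t - s) / 2))\<^sup>2"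
    by (simp add: power_mult_distrib)
  finally have "(dist (semicircle_path c r u v s) (semicircle_path c r u v t))\<^sup>2
      = (2 * r * sin ((t - s) / 2))\<^sup>2" .
  moreover have "0 \<le> 2 * r * sin ((t - s) / 2)"
    using assms(1,5,6) by (simp add: sin_ge_zero)
  ultimately show ?thesis
    using power2_eq_imp_eq zero_le_dist by blast
qed

lemma sin_sq_add_double_product:
  fixes a b :: real
  shows "(sin (b - a))\<^sup>2 + 2 * sin a * sin (b - a) * cos b = (sin b)\<^sup>2 - (sin a)\<^sup>2"
proof -
  have "(sin (b - a))\<^sup>2 + 2 * sin a * sin (b - a) * cos b
      = (sin b * cos a)\<^sup>2 - (sin a * cos b)\<^sup>2"
    by (simp add: sin_diff power2_eq_square algebra_simps)
  also have "\<dots> = (sin b)\<^sup>2 - (sin a)\<^sup>2"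
    by (simp add: power_mult_distrib cos_squared_eq algebra_simps)
  finally show ?thesis .
qed

text \<open>
  The sign of the last summand is positive because the angle at \<open>X\<close> of the triangle \<open>P X Y\<close> is
  obtuse: being supplementary to the angle at \<open>Q\<close>, it has cosine \<open>- dist Y Q / dist P Q\<close>.
\<close>

lemma law_of_cosines_in_semicircle:
  fixes c u v :: "real^2" and r s t :: real
  assumes "r > 0" "norm u = 1" "norm v = 1" "u \<bullet> v = 0"
    and "0 \<le> s" "s \<le> t" "t \<le> pi"
  defines "P \<equiv> semicircle_path c r u v 0" and "X \<equiv> semicircle_path c r u v s"
    and "Y \<equiv> semicircle_path c r u v t" and "Q \<equiv> semicircle_path c r u v pi"
  shows "(dist P Y)\<^sup>2 - (dist P X)\<^sup>2 = (dist X Y)\<^sup>2 + 2 * (dist P X * dist X Y * dist Y Q / dist P Q)"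
proof -
  have chord: "dist (semicircle_path c r u v x) (semicircle_path c r u v y)
      = 2 * r * sin ((y - x) / 2)" if "0 \<le> x" "x \<le> y" "y \<le> pi" for x y
    using that assms(1-4) pi_ge_zero by (intro dist_semicircle_path) linarith+
  have PX: "dist P X = 2 * r * sin (s / 2)" and PY: "dist P Y = 2 * r * sin (t / 2)"
    and XY: "dist X Y = 2 * r * sin (t / 2 - s / 2)" and PQ: "dist P Q = 2 * r"
    unfolding P_def X_def Y_def Q_def using assms(5-7) by (simp_all add: chord diff_divide_distrib)
  \<comment> \<open>The triangle with vertices \<open>P\<close>, \<open>Y\<close>, \<open>Q\<close> has a right angle at \<open>Y\<close>.\<close>
  have YQ: "dist Y Q = 2 * r * cos (t / 2)"
    unfolding Y_def Q_def using assms(5-7)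
    by (simp add: chord diff_divide_distrib cos_sin_eq)
  have "(dist P Y)\<^sup>2 - (dist P X)\<^sup>2 = 4 * r\<^sup>2 * ((sin (t / 2))\<^sup>2 - (sin (s / 2))\<^sup>2)"
    by (simp add: PX PY power_mult_distrib algebra_simps)
  also have "\<dots> = 4 * r\<^sup>2 * ((sin (t / 2 - s / 2))\<^sup>2
      + 2 * sin (s / 2) * sin (t / 2 - s / 2) * cos (t / 2))"
    by (simp only: sin_sq_add_double_product)
  also have "\<dots> = (dist X Y)\<^sup>2 + 2 * (dist P X * dist X Y * dist Y Q / dist P Q)"
    using assms(1) by (simp add: PX XY YQ PQ power2_eq_square field_simps)
  finally show ?thesis .
qed

theorem theorem5:
  fixes A :: "nat \<Rightarrow> real^2" and n :: nat
  assumes "simple_polygon n A"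
    and "inscribed_in_semicircle n A"
  shows "(dist (A 1) (A n))\<^sup>2 =
      (\<Sum>k=1..n-1. (dist (A k) (A (k+1)))\<^sup>2) +
      2 * (\<Sum>k=1..n-3.
        dist (A 1) (A (k+1)) * dist (A (k+1)) (A (k+2)) * dist (A (k+2)) (A n) / dist (A 1) (A n))"
proof -
  from assms(1) have n: "3 \<le> n"
    by (simp add: simple_polygon_def)
  from assms(2) obtain c r u v \<theta> where
    frame: "r > 0" "norm u = 1" "norm v = 1" "u \<bullet> v = 0"
    and ends: "\<theta> 1 = 0" "\<theta> n = pi" and mono: "strict_mono_on {1..n} \<theta>"
    and A: "\<And>k. k \<in> {1..n} \<Longrightarrow> A k = semicircle_path c r u v (\<theta> k)"
    unfolding inscribed_in_semicircle_def by blast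
  have \<theta>_le: "\<theta> i \<le> \<theta> j" if "1 \<le> i" "i \<le> j" "j \<le> n" for i j
    using that strict_mono_on_leD[OF mono] by simp
  define p where
    "p k = dist (A 1) (A k) * dist (A k) (A (k+1)) * dist (A (k+1)) (A n) / dist (A 1) (A n)" for k
  have step: "(dist (A 1) (A (k+1)))\<^sup>2 - (dist (A 1) (A k))\<^sup>2 = (dist (A k) (A (k+1)))\<^sup>2 + 2 * p k"
    if k: "k \<in> {1..n-1}" for k
  proof -
    have "0 \<le> \<theta> k" "\<theta> k \<le> \<theta> (k+1)" "\<theta> (k+1) \<le> pi"
      using \<theta>_le[of 1 k] \<theta>_le[of k "k+1"] \<theta>_le[of "k+1" n] ends k n by auto
    moreover have "A 1 = semicircle_path c r u v 0" "A n = semicircle_path c r u v pi"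
      "A k = semicircle_path c r u v (\<theta> k)" "A (k+1) = semicircle_path c r u v (\<theta> (k+1))"
      using A[of 1] A[of n] A[of k] A[of "k+1"] ends k n by auto
    ultimately show ?thesis
      unfolding p_def using law_of_cosines_in_semicircle[OF frame] by metis
  qed
  have "(dist (A 1) (A n))\<^sup>2
      = (\<Sum>k=1..n-1. (dist (A 1) (A (k+1)))\<^sup>2 - (dist (A 1) (A k))\<^sup>2)"
    using sum_Suc_diff[of 1 "n-1" "\<lambda>k. (dist (A 1) (A k))\<^sup>2"] n by simp
  also have "\<dots> = (\<Sum>k=1..n-1. (dist (A k) (A (k+1)))\<^sup>2) + 2 * (\<Sum>k=1..n-1. p k)"
    by (simp only: step sum.distrib sum_distrib_left cong: sum.cong)
  also have "(\<Sum>k=1..n-1. p k) = (\<Sum>k=2..n-2. p k)"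
  proof (rule sum.mono_neutral_right)
    show "\<forall>k\<in>{1..n-1} - {2..n-2}. p k = 0"
    proof
      fix k assume "k \<in> {1..n-1} - {2..n-2}"
      then have "k = 1 \<or> k + 1 = n" by auto
      then show "p k = 0" by (auto simp: p_def)
    qed
  qed auto
  also have "(\<Sum>k=2..n-2. p k) = (\<Sum>k=1..n-3. p (k+1))"
    using sum.shift_bounds_cl_nat_ivl[of p 1 1 "n-3"] n by (simp add: numeral_eq_Suc Suc_diff_Suc)
  finally show ?thesis
    by (simp add: p_def)
qed

end
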